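(* Let $G$ be a connected block graph. Then $\mathrm{ip}(G)=\lceil \mathrm{nc}(G)/2\rceil$, where $\mathrm{nc}(G)$ is the number of non-cut-vertices of $G$.
   Context: Graphs are finite, simple and nonempty. A block graph is a graph in which every block (maximal connected subgraph without a cut-vertex of its own) is a complete graph. A cut-vertex of a graph is a vertex whose removal results in a graph with more components than the original graph; a non-cut-vertex is a vertex that is not a cut-vertex. An isometric path between two vertices of $G$ is a shortest path in $G$ joining them; the two vertices may coincide, so a single vertex is an isometric path (of length 0). The isometric-path number $\mathrm{ip}(G)$ is the minimum number of isometric paths of $G$ required to cover all vertices of $G$ (i.e. such that every vertex lies on at least one of the paths). *)

theory Defs
  imports "Graph_Theory.Graph_Theory"
begin

text \<open>
  A finite simple undirected graph is a symmetric digraph satisfying the library locale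
  \<^locale>\<open>graph\<close> (finite, no loops, no parallel arcs); every undirected edge is a pair of
  opposite arcs. On such digraphs the strongly connected components are the usual components.
\<close>

definition num_components :: "('a, 'b) pre_digraph \<Rightarrow> nat" where
  "num_components G = card (pre_digraph.sccs G)"

definition cut_vertex :: "('a, 'b) pre_digraph \<Rightarrow> 'a \<Rightarrow> bool" where
  "cut_vertex G v \<longleftrightarrow>
     v \<in> verts G \<and> num_components G < num_components (pre_digraph.del_vert G v)"

text \<open>
  Subgraphs in the library are arbitrary subdigraphs; the conjunct \<^term>\<open>graph H\<close> restricts
  them to symmetric ones, i.e. to subgraphs in the undirected sense.
\<close>

definition is_block :: "('a, 'b) pre_digraph \<Rightarrow> ('a, 'b) pre_digraph \<Rightarrow> bool" where
  "is_block G B \<longleftrightarrow>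
     pre_digraph.max_subgraph G (\<lambda>H. graph H \<and> connected H \<and> (\<nexists>v. cut_vertex H v)) B"

definition block_graph :: "('a, 'b) pre_digraph \<Rightarrow> bool" where
  "block_graph G \<longleftrightarrow> (\<forall>B. is_block G B \<longrightarrow> (\<exists>n. complete_digraph n B))"

text \<open>
  Paths are nonempty lists of distinct vertices, so \<^term>\<open>[v]\<close> is a path of length 0.
\<close>

definition isometric_path :: "('a, 'b) pre_digraph \<Rightarrow> 'a list \<Rightarrow> bool" where
  "isometric_path G p \<longleftrightarrow>
     vpath p G \<and>
     (\<forall>q. vpath q G \<and> hd q = hd p \<and> last q = last p \<longrightarrow> vwalk_length p \<le> vwalk_length q)"

definition isometric_path_cover :: "('a, 'b) pre_digraph \<Rightarrow> 'a list set \<Rightarrow> bool" where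
  "isometric_path_cover G P \<longleftrightarrow>
     finite P \<and> (\<forall>p\<in>P. isometric_path G p) \<and> (\<forall>v\<in>verts G. \<exists>p\<in>P. v \<in> set p)"

text \<open>
  For finite graphs the minimum is attained, since the one-vertex paths form a cover.
\<close>

definition ip :: "('a, 'b) pre_digraph \<Rightarrow> nat" where
  "ip G = (LEAST k. \<exists>P. isometric_path_cover G P \<and> card P = k)"

definition nc :: "('a, 'b) pre_digraph \<Rightarrow> nat" where
  "nc G = card {v \<in> verts G. \<not> cut_vertex G v}"

end

theory Submission
  imports Defs
begin

text \<open>
  In a block graph two neighbours of \<open>v\<close> that lie in one component of \<open>G - v\<close> are adjacent, since
  they lie with \<open>v\<close> on a cycle and hence in a block. So every inner vertex of an isometric path is a
  cut-vertex, and each path covers at most two non-cut-vertices.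

  Conversely, arrange the non-cut-vertices in \<open>\<lceil>nc / 2\<rceil>\<close> pairs (one of them twice if their number is
  odd) so that the sum of the distances within the pairs is maximal, and join each pair by an
  isometric path. Suppose that the cut-vertex \<open>v\<close> is not covered. Then no pair is separated by \<open>v\<close>,
  but every component of \<open>G - v\<close> contains a non-cut-vertex, so there are pairs \<open>x, y\<close> and \<open>x', y'\<close> in
  different components. The distances of \<open>x, y'\<close> and \<open>x', y\<close> are then attained through \<open>v\<close>, whereas
  those of \<open>x, y\<close> and \<open>x', y'\<close> are strictly smaller than the detours through \<open>v\<close>; exchanging
  partners increases the sum.
\<close>

section \<open>Walks and reachability in induced subgraphs\<close>

lemma vwalk_append_iff:
  assumes "p \<noteq> []" "q \<noteq> []"
  shows "vwalk (p @ q) G \<longleftrightarrow> vwalk p G \<and> vwalk q G \<and> (last p, hd q) \<in> arcs_ends G"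
  using assms by (auto simp: vwalk_def vwalk_arcs_append)

lemma (in wf_digraph) del_vert_eq_induce: "del_vert u = G \<restriction> (verts G - {u})"
  unfolding del_vert_def induce_subgraph_def by auto

lemma induce_induce_subgraph: "T \<subseteq> S \<Longrightarrow> (G \<restriction> S) \<restriction> T = G \<restriction> T"
  unfolding induce_subgraph_def by auto

lemma (in graph) graph_induce: "S \<subseteq> verts G \<Longrightarrow> graph (G \<restriction> S)"
  by (meson digraph.graphI digraphI_induced induced_graph_imp_symmetric induced_induce sym_arcs)

lemma arcs_ends_induce_subgraph: "arcs_ends (G \<restriction> S) = arcs_ends G \<inter> S \<times> S"
  by (auto simp: arcs_ends_conv)

lemma vwalk_induce:
  assumes "vwalk p G" "set p \<subseteq> S"
  shows "vwalk p (G \<restriction> S)"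
proof -
  have "set (vwalk_arcs p) \<subseteq> set p \<times> set p"
    by (auto dest: arcs_in_vwalk_arcs)
  then show ?thesis
    using assms unfolding vwalk_def arcs_ends_induce_subgraph induce_subgraph_verts by blast
qed

lemma vwalk_of_induce:
  assumes "vwalk p (G \<restriction> S)" "S \<subseteq> verts G"
  shows "vwalk p G"
  using assms unfolding vwalk_def arcs_ends_induce_subgraph induce_subgraph_verts by blast

text \<open>Every vertex of \<open>p\<close> reaches \<open>last p\<close> along the rest of
  \<open>p\<close>, and symmetry reverses one of two such walks. This turns a walk that avoids a
  vertex into reachability after deleting that vertex.\<close>

lemma (in graph) vwalk_reachable_induce:
  assumes "vwalk p G" "set p \<subseteq> S" "x \<in> set p" "y \<in> set p"
  shows "x \<rightarrow>\<^sup>*\<^bsub>G \<restriction> S\<^esub> y"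
proof -
  interpret S: wf_digraph "G \<restriction> S" by (rule wellformed_induce_subgraph)
  have to_last: "z \<rightarrow>\<^sup>*\<^bsub>G \<restriction> S\<^esub> last p" if "z \<in> set p" for z
  proof -
    obtain q r where "p = q @ z # r" using \<open>z \<in> set p\<close> by (auto dest: split_list)
    moreover have "vwalk p (G \<restriction> S)" using assms by (intro vwalk_induce)
    ultimately have "vwalk (z # r) (G \<restriction> S)" "last (z # r) = last p"
      by (auto intro: vwalkI_append_r)
    then show ?thesis unfolding S.reachable_vwalk_conv by (intro exI[of _ "z # r"]) auto
  qed
  have "symmetric (G \<restriction> S)"
    using sym_arcs by (fastforce simp: symmetric_conv)
  then show ?thesis
    using to_last assms(3,4) by (blast intro: S.reachable_trans symmetric_reachable)
qed

section \<open>Components, cut-vertices and maximal subgraphs\<close>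

lemma (in graph) num_components_connected:
  assumes "connected G"
  shows "num_components G = 1"
  using symmetric_connected_imp_strongly_connected[OF sym_arcs assms]
  by (simp add: num_components_def strongly_connected_eq_iff)

text \<open>A connected graph has exactly one component, so \<open>v\<close> is a cut-vertex iff its
  deletion leaves at least two, that is, two vertices in different components.\<close>

lemma (in graph) cut_vertex_iff:
  assumes "connected G" "v \<in> verts G"
  shows "cut_vertex G v \<longleftrightarrow>
    (\<exists>a \<in> verts G - {v}. \<exists>b \<in> verts G - {v}. \<not> a \<rightarrow>\<^sup>*\<^bsub>G \<restriction> (verts G - {v})\<^esub> b)"
    (is "_ \<longleftrightarrow> (\<exists>a \<in> ?V. \<exists>b \<in> ?V. \<not> a \<rightarrow>\<^sup>*\<^bsub>?D\<^esub> b)")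
proof -
  interpret D: graph ?D by (rule graph_induce) auto
  have cut: "cut_vertex G v \<longleftrightarrow> 1 < card D.sccs_verts"
    using assms num_components_connected
    by (simp add: cut_vertex_def num_components_def del_vert_eq_induce D.card_sccs_verts)
  show ?thesis
  proof
    assume "cut_vertex G v"
    then have "1 < card D.sccs_verts" by (simp add: cut)
    then obtain S T where "S \<in> D.sccs_verts" "T \<in> D.sccs_verts" "S \<noteq> T"
      using card_le_Suc0_iff_eq[OF D.finite_sccs_verts] by (metis One_nat_def not_le)
    then obtain a b where "a \<in> ?V" "b \<in> ?V" "D.scc_of a \<noteq> D.scc_of b"
      unfolding D.sccs_verts_conv_scc_of by auto
    moreover have "D.scc_of a = D.scc_of b" if "a \<rightarrow>\<^sup>*\<^bsub>?D\<^esub> b"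
      using that D.scc_ofI_reachable D.scc_of_eq by blast
    ultimately show "\<exists>a \<in> ?V. \<exists>b \<in> ?V. \<not> a \<rightarrow>\<^sup>*\<^bsub>?D\<^esub> b" by blast
  next
    assume "\<exists>a \<in> ?V. \<exists>b \<in> ?V. \<not> a \<rightarrow>\<^sup>*\<^bsub>?D\<^esub> b"
    then obtain a b where ab: "a \<in> ?V" "b \<in> ?V" "\<not> a \<rightarrow>\<^sup>*\<^bsub>?D\<^esub> b" by blast
    have sccs: "D.scc_of a \<in> D.sccs_verts" "D.scc_of b \<in> D.sccs_verts"
      using ab by (auto intro: D.scc_of_in_sccs_verts)
    have "b \<in> D.scc_of b" using ab by (auto intro: D.in_scc_of_self)
    moreover have "b \<notin> D.scc_of a" using ab by (simp add: D.scc_of_def)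
    ultimately have "D.scc_of a \<noteq> D.scc_of b" by blast
    with sccs have "\<not> card D.sccs_verts \<le> Suc 0"
      using card_le_Suc0_iff_eq[OF D.finite_sccs_verts] by blast
    then show "cut_vertex G v" by (simp add: cut)
  qed
qed

text \<open>Supplies the block around a given subgraph. Among the subgraphs above \<open>H\<close>
  with property \<open>P\<close>, one with the largest number of vertices plus arcs is maximal,
  since a proper extension would increase this number.\<close>

lemma (in fin_digraph) ex_max_subgraph:
  assumes "subgraph H G" "P H"
  obtains B where "max_subgraph P B" "subgraph H B"
proof -
  let ?Q = "\<lambda>B. subgraph B G \<and> P B \<and> subgraph H B"
  let ?size = "\<lambda>B. card (verts B) + card (arcs B)"
  have "?Q H" using assms by (auto intro: wf_digraph.subgraph_refl)
  moreover have "\<forall>B. ?Q B \<longrightarrow> ?size B < Suc (?size G)"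
    by (auto intro!: add_mono card_mono simp: less_Suc_eq_le)
  ultimately obtain B where B: "?Q B" "\<And>B'. ?Q B' \<Longrightarrow> ?size B' \<le> ?size B"
    using ex_has_greatest_nat[of ?Q H ?size] by blast
  have "max_subgraph P B"
  proof (rule max_subgraphI)
    fix B' assume B': "B \<noteq> B'" "subgraph B B'" "subgraph B' G"
    show "\<not> P B'"
    proof
      assume "P B'"
      then have le: "?size B' \<le> ?size B" using B B' by (meson subgraph_trans)
      interpret B': fin_digraph B' using B'(3) by (rule fin_digraph_subgraph)
      have sub: "verts B \<subseteq> verts B'" "arcs B \<subseteq> arcs B'" "tail B' = tail B" "head B' = head B"
        using B'(2) by (auto simp: compatible_def)
      moreover have "card (verts B) \<le> card (verts B')" "card (arcs B) \<le> card (arcs B')"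
        using sub by (auto intro: card_mono)
      ultimately have "card (verts B) = card (verts B')" "card (arcs B) = card (arcs B')"
        using le by linarith+
      then have "verts B = verts B'" "arcs B = arcs B'"
        using sub by (simp_all add: card_subset_eq)
      then have "B = B'" using sub by (intro pre_digraph.equality) simp_all
      with B'(1) show False by contradiction
    qed
  qed (use B in auto)
  with B show ?thesis using that by blast
qed

section \<open>Distances and isometric paths in connected graphs\<close>

locale connected_graph = graph +
  assumes connected: "connected G"
begin

lemma reachable_all: "u \<in> verts G \<Longrightarrow> v \<in> verts G \<Longrightarrow> u \<rightarrow>\<^sup>* v"
  using symmetric_connected_imp_strongly_connected[OF sym_arcs connected]
  by (auto simp: strongly_connected_def)

text \<open>The minimum ranges over walks rather than paths, so that cut or concatenated walks give
  bounds without a check of distinctness. A walk with \<open>Suc n\<close> vertices has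
  \<open>n\<close> edges.\<close>

definition gdist :: "'a \<Rightarrow> 'a \<Rightarrow> nat" where
  "gdist u v = (LEAST n. \<exists>p. vwalk p G \<and> hd p = u \<and> last p = v \<and> length p = Suc n)"

lemma ex_gdist_vwalk:
  assumes "u \<in> verts G" "v \<in> verts G"
  obtains p where "vwalk p G" "hd p = u" "last p = v" "length p = Suc (gdist u v)"
proof -
  obtain p where "vwalk p G" "hd p = u" "last p = v"
    using reachable_all[OF assms] by (auto simp: reachable_vwalk_conv)
  moreover from this have "length p = Suc (length p - 1)" by (cases p) auto
  ultimately have "\<exists>n p. vwalk p G \<and> hd p = u \<and> last p = v \<and> length p = Suc n" by blast
  from LeastI_ex[OF this] show ?thesis using that unfolding gdist_def by blast
qed

lemma gdist_less_length:
  assumes "vwalk p G"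
  shows "gdist (hd p) (last p) < length p"
proof -
  have "length p = Suc (length p - 1)" using assms by (cases p) auto
  then have "gdist (hd p) (last p) \<le> length p - 1"
    unfolding gdist_def by (intro Least_le) (use assms in blast)
  with \<open>length p = _\<close> show ?thesis by linarith
qed

lemma gdist_less_card:
  assumes "u \<in> verts G" "v \<in> verts G"
  shows "gdist u v < card (verts G)"
proof -
  obtain p where p: "vpath p G" "hd p = u" "last p = v"
    using reachable_all[OF assms] by (auto simp: reachable_vpath_conv)
  then have "length p = card (set p)" by (auto simp: distinct_card)
  also have "\<dots> \<le> card (verts G)" using p by (auto intro!: card_mono elim!: vpathE)
  finally show ?thesis using gdist_less_length[of p] p by (auto simp: vpath_def)
qed

text \<open>Cutting out the closed stretch between two occurrences of a vertex would leave a shorter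
  walk with the same ends.\<close>

lemma minimal_vwalk_distinct:
  assumes "vwalk p G" "length p = Suc (gdist (hd p) (last p))"
  shows "distinct p"
proof (rule ccontr)
  assume "\<not> distinct p"
  then obtain xs ys zs y where p: "p = xs @ [y] @ ys @ [y] @ zs"
    using not_distinct_decomp by blast
  define q where "q = xs @ [y] @ zs"
  have "vwalk ((xs @ [y]) @ (ys @ [y] @ zs)) G" using assms p by simp
  then have 1: "vwalk (xs @ [y]) G" by (rule vwalkI_append_l[rotated]) simp
  have "vwalk ((xs @ [y] @ ys) @ (y # zs)) G" using assms p by simp
  then have 2: "vwalk (y # zs) G" by (rule vwalkI_append_r[rotated]) simp
  have "vwalk (xs @ y # zs) G"
    using 1 2 by (cases "xs = []") (auto simp: vwalk_append_iff)
  then have "vwalk q G" by (simp add: q_def)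
  moreover have "hd q = hd p" "last q = last p" by (auto simp: q_def p hd_append)
  ultimately have "gdist (hd p) (last p) < length q" using gdist_less_length by metis
  then show False using assms by (simp add: p q_def)
qed

text \<open>A shortest walk is a path, so minimality among paths and minimality among walks
  agree.\<close>

lemma isometric_path_iff:
  "isometric_path G p \<longleftrightarrow> vwalk p G \<and> length p = Suc (gdist (hd p) (last p))"
proof
  assume p: "isometric_path G p"
  then have walk: "vwalk p G" by (auto simp: isometric_path_def)
  then have "hd p \<in> verts G" "last p \<in> verts G" by (auto simp: vwalk_def subset_iff)
  then obtain q where q: "vwalk q G" "hd q = hd p" "last q = last p"
      "length q = Suc (gdist (hd p) (last p))"
    by (rule ex_gdist_vwalk)
  then have "vpath q G" using minimal_vwalk_distinct[of q] by auto
  then have "length p - 1 \<le> length q - 1"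
    using p q unfolding isometric_path_def vwalk_length_simp by blast
  with q gdist_less_length[OF walk] show "vwalk p G \<and> length p = Suc (gdist (hd p) (last p))"
    using walk by auto
next
  assume p: "vwalk p G \<and> length p = Suc (gdist (hd p) (last p))"
  have "vwalk_length p \<le> vwalk_length q" if "vpath q G" "hd q = hd p" "last q = last p" for q
    using that p gdist_less_length[of q] by (auto simp: vpath_def)
  moreover have "vpath p G" using p minimal_vwalk_distinct by blast
  ultimately show "isometric_path G p" unfolding isometric_path_def by blast
qed

lemma ex_isometric_path:
  assumes "u \<in> verts G" "v \<in> verts G"
  obtains p where "isometric_path G p" "hd p = u" "last p = v"
  using ex_gdist_vwalk[OF assms] isometric_path_iff by metis

text \<open>Every walk from \<open>x\<close> to \<open>y\<close> must pass through \<open>v\<close>;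
  a shortest one is split there.\<close>

lemma gdist_add_le_if_separated:
  assumes "v \<in> verts G" "x \<in> verts G" "y \<in> verts G" "\<not> x \<rightarrow>\<^sup>*\<^bsub>G \<restriction> (verts G - {v})\<^esub> y"
  shows "gdist x v + gdist v y \<le> gdist x y"
proof -
  obtain p where p: "vwalk p G" "hd p = x" "last p = y" "length p = Suc (gdist x y)"
    using assms by (blast intro: ex_gdist_vwalk)
  have "v \<in> set p"
  proof (rule ccontr)
    assume "v \<notin> set p"
    then have "set p \<subseteq> verts G - {v}" using p by auto
    moreover have "x \<in> set p" "y \<in> set p" using p by auto
    ultimately show False using vwalk_reachable_induce p(1) assms(4) by blast
  qed
  then obtain q r where qr: "p = q @ v # r" by (auto dest: split_list)
  have "vwalk ((q @ [v]) @ r) G" "vwalk (q @ (v # r)) G" using p qr by auto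
  then have "vwalk (q @ [v]) G" "vwalk (v # r) G"
    by (auto intro: vwalkI_append_l vwalkI_append_r simp del: append_assoc)
  from this[THEN gdist_less_length] show ?thesis
    using p qr by (cases q) auto
qed

section \<open>Existence of non-cut-vertices\<close>

text \<open>A vertex of the component at maximal distance from \<open>v\<close> will do: its
  deletion leaves all other vertices joined to \<open>v\<close>.\<close>

lemma ex_non_cut_vertex_in_component:
  assumes "v \<in> verts G" "c \<in> verts G - {v}"
  obtains w where "w \<in> verts G" "\<not> cut_vertex G w" "c \<rightarrow>\<^sup>*\<^bsub>G \<restriction> (verts G - {v})\<^esub> w"
proof -
  let ?D = "G \<restriction> (verts G - {v})"
  interpret D: graph ?D by (rule graph_induce) auto
  have "c \<rightarrow>\<^sup>*\<^bsub>?D\<^esub> c" using assms by (intro D.reachable_refl) auto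
  moreover have "\<forall>w. c \<rightarrow>\<^sup>*\<^bsub>?D\<^esub> w \<longrightarrow> gdist w v < card (verts G)"
    using assms by (auto intro!: gdist_less_card dest: D.reachable_in_verts)
  ultimately obtain w where w: "c \<rightarrow>\<^sup>*\<^bsub>?D\<^esub> w" "\<And>u. c \<rightarrow>\<^sup>*\<^bsub>?D\<^esub> u \<Longrightarrow> gdist u v \<le> gdist w v"
    using ex_has_greatest_nat[of "\<lambda>w. c \<rightarrow>\<^sup>*\<^bsub>?D\<^esub> w" c "\<lambda>w. gdist w v"] by blast
  have wV: "w \<in> verts G" "w \<noteq> v" using D.reachable_in_verts[OF w(1)] by auto
  interpret W: graph "G \<restriction> (verts G - {w})" by (rule graph_induce) auto
  \<comment> \<open>Since \<open>w\<close> is farthest from \<open>v\<close> in its component, no geodesic to \<open>v\<close> from another vertex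
    passes through \<open>w\<close>.\<close>
  have to_v: "u \<rightarrow>\<^sup>*\<^bsub>G \<restriction> (verts G - {w})\<^esub> v" if u: "u \<in> verts G - {w}" for u
  proof -
    have "u \<in> verts G" using u by blast
    then obtain p where p: "isometric_path G p" "hd p = u" "last p = v"
      using ex_isometric_path assms(1) by blast
    then have walk: "vwalk p G" and len: "length p = Suc (gdist u v)" and dist: "distinct p"
      by (auto simp: isometric_path_iff minimal_vwalk_distinct)
    \<comment> \<open>If \<open>w\<close> were on \<open>p\<close>, the part of \<open>p\<close> up
      to \<open>w\<close> would avoid \<open>v\<close> and put \<open>u\<close> into the component
      of \<open>w\<close>. Then \<open>u\<close> is at most as far from \<open>v\<close> as
      \<open>w\<close> is, although \<open>w\<close> comes strictly later on a shortest walk to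
      \<open>v\<close>.\<close>
    have "w \<notin> set p"
    proof
      assume "w \<in> set p"
      then obtain q r where qr: "p = q @ w # r" by (auto dest: split_list)
      have q: "q \<noteq> []" and r: "r \<noteq> []" using qr p u wV by auto
      have "vwalk ((q @ [w]) @ r) G" "vwalk (q @ (w # r)) G" using walk qr by auto
      then have walks: "vwalk (q @ [w]) G" "vwalk (w # r) G"
        by (auto intro: vwalkI_append_l vwalkI_append_r simp del: append_assoc)
      have "v \<in> set r" using r p qr by auto
      then have "v \<notin> set (q @ [w])" using dist qr by auto
      then have "set (q @ [w]) \<subseteq> verts G - {v}" using walks(1) by (auto simp: vwalk_def)
      moreover have "u \<in> set (q @ [w])" using p qr q by auto
      ultimately have "w \<rightarrow>\<^sup>*\<^bsub>?D\<^esub> u" using vwalk_reachable_induce[OF walks(1)] by simp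
      then have "gdist u v \<le> gdist w v" using w D.reachable_trans by blast
      moreover have "gdist w v \<le> length r"
        using gdist_less_length[OF walks(2)] r p qr by auto
      moreover have "length r < gdist u v" using len qr q by (cases q) auto
      ultimately show False by simp
    qed
    then have "set p \<subseteq> verts G - {w}" using walk by auto
    moreover have "u \<in> set p" "v \<in> set p" using p walk by auto
    ultimately show ?thesis using vwalk_reachable_induce walk by blast
  qed
  then have "a \<rightarrow>\<^sup>*\<^bsub>G \<restriction> (verts G - {w})\<^esub> b" if "a \<in> verts G - {w}" "b \<in> verts G - {w}" for a b
    using that W.reachable_trans W.symmetric_reachable' by blast
  then have "\<not> cut_vertex G w" using cut_vertex_iff[OF connected] wV by blast
  with wV w show ?thesis using that by blast
qed

text \<open>In a one-vertex graph nothing is left to be separated; otherwise the component of any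
  second vertex provides one.\<close>

lemma ex_non_cut_vertex: "\<exists>v \<in> verts G. \<not> cut_vertex G v"
proof -
  obtain v where v: "v \<in> verts G" using connected by (auto simp: connected_conv)
  show ?thesis
  proof (cases "verts G - {v} = {}")
    case True
    then show ?thesis using v cut_vertex_iff[OF connected] by blast
  next
    case False
    then show ?thesis using v ex_non_cut_vertex_in_component by blast
  qed
qed

end

section \<open>Isometric paths and distances in block graphs\<close>

locale connected_block_graph = connected_graph +
  assumes block: "block_graph G"
begin

text \<open>A path from \<open>a\<close> to \<open>b\<close> avoiding \<open>v\<close> closes
  through \<open>v\<close> to a cycle. The subgraph induced on its vertices is connected and has no
  cut-vertex, so it extends to a block, which is complete.\<close>

lemma neighbours_adjacent_if_reachable:
  assumes "(v, a) \<in> arcs_ends G" "(v, b) \<in> arcs_ends G" "a \<noteq> b"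
    and "a \<rightarrow>\<^sup>*\<^bsub>G \<restriction> (verts G - {v})\<^esub> b"
  shows "(a, b) \<in> arcs_ends G"
proof -
  interpret D: graph "G \<restriction> (verts G - {v})" by (rule graph_induce) auto
  have v: "v \<in> verts G" using assms adj_in_verts by auto
  obtain q where q: "vpath q (G \<restriction> (verts G - {v}))" "hd q = a" "last q = b"
    using assms by (auto simp: D.reachable_vpath_conv)
  then have walk: "vwalk q G" and q_sub: "set q \<subseteq> verts G - {v}" and dist: "distinct q"
    using vwalk_of_induce[of q G "verts G - {v}"] by (auto simp: vpath_def vwalk_def[of q])
  have ends: "a \<in> set q" "b \<in> set q" using walk q by auto
  define S where "S = insert v (set q)"
  have S: "S \<subseteq> verts G" using v q_sub by (auto simp: S_def)
  interpret H: graph "G \<restriction> S" using S by (rule graph_induce)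
  have walks: "vwalk (v # q) G"
    using assms walk q v by (intro vwalk_consI) auto
  have conn: "connected (G \<restriction> S)"
  proof (rule H.connectedI)
    fix x y assume "x \<in> verts (G \<restriction> S)" "y \<in> verts (G \<restriction> S)"
    then show "x \<rightarrow>\<^sup>*\<^bsub>mk_symmetric (G \<restriction> S)\<^esub> y"
      by (intro H.reachable_mk_symmetricI vwalk_reachable_induce[OF walks]) (auto simp: S_def)
  qed (simp add: S_def)
  have "\<not> cut_vertex (G \<restriction> S) u" for u
  proof (cases "u \<in> S")
    case False
    then show ?thesis by (simp add: cut_vertex_def)
  next
    case True
    have "x \<rightarrow>\<^sup>*\<^bsub>G \<restriction> (S - {u})\<^esub> y" if xy: "x \<in> S - {u}" "y \<in> S - {u}" for x y
    proof (cases "u = v")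
      case True
      then show ?thesis
        using xy q_sub by (intro vwalk_reachable_induce[OF walk]) (auto simp: S_def)
    next
      case False
      then obtain q1 q2 where qu: "q = q1 @ u # q2"
        using \<open>u \<in> S\<close> by (auto simp: S_def dest: split_list)
      interpret U: graph "G \<restriction> (S - {u})" using S by (intro graph_induce) auto
      \<comment> \<open>Deleting \<open>u\<close> breaks the cycle into the walks
        \<open>v # q1\<close> and \<open>q2 @ [v]\<close>, so each remaining vertex still reaches
        \<open>v\<close>. The second walk is just \<open>[v]\<close> when
        \<open>u = b\<close>.\<close>
      have "vwalk ((v # q1) @ (u # q2)) G" using walks qu by simp
      then have 1: "vwalk (v # q1) G" by (rule vwalkI_append_l[rotated]) simp
      have "vwalk (q2 @ [v]) G"
      proof (cases "q2 = []")
        case False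
        then have "vwalk q2 G" "last q2 = b"
          using walk qu q vwalkI_append_r[of q2 "q1 @ [u]" G] by auto
        then show ?thesis
          using False v assms graph_symmetric by (simp add: vwalk_append_iff)
      qed (use v in simp)
      note 2 = this
      have to_v: "z \<rightarrow>\<^sup>*\<^bsub>G \<restriction> (S - {u})\<^esub> v" if z: "z \<in> S - {u}" for z
      proof -
        have "set (v # q1) \<subseteq> S - {u}" "set (q2 @ [v]) \<subseteq> S - {u}"
          using dist qu False by (auto simp: S_def)
        moreover have "z \<in> set (v # q1) \<or> z \<in> set (q2 @ [v])"
          using z qu by (auto simp: S_def)
        ultimately show ?thesis
          using vwalk_reachable_induce[OF 1] vwalk_reachable_induce[OF 2]
          by (metis list.set_intros(1) in_set_conv_decomp)
      qed
      show ?thesis using to_v xy U.reachable_trans U.symmetric_reachable' by blast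
    qed
    then show ?thesis
      using H.cut_vertex_iff[OF conn] True
      by (simp add: induce_induce_subgraph)
  qed
  then have "graph (G \<restriction> S) \<and> connected (G \<restriction> S) \<and> (\<nexists>u. cut_vertex (G \<restriction> S) u)"
    using conn H.graph_axioms by blast
  then obtain B where B: "is_block G B" "subgraph (G \<restriction> S) B"
    using ex_max_subgraph[OF subgraph_induce_subgraphI[OF S],
        of "\<lambda>H. graph H \<and> connected H \<and> (\<nexists>v. cut_vertex H v)"]
    unfolding is_block_def by blast
  then obtain n where "complete_digraph n B" using block by (auto simp: block_graph_def)
  moreover have "a \<in> verts B" "b \<in> verts B"
    using B(2) ends by (auto simp: S_def dest!: subgraph_imp_subverts)
  ultimately have "(a, b) \<in> arcs_ends B" using assms by (simp add: complete_digraph_def)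
  moreover have "subgraph B G" using B by (auto simp: is_block_def max_subgraph_def)
  ultimately show ?thesis using arcs_ends_mono by blast
qed

text \<open>Otherwise \<open>a\<close> and \<open>b\<close> are adjacent, and skipping
  \<open>v\<close> gives a shorter walk with the same ends.\<close>

lemma isometric_path_interior_separates:
  assumes p: "isometric_path G (q @ [a, v, b] @ r)"
  shows "\<not> a \<rightarrow>\<^sup>*\<^bsub>G \<restriction> (verts G - {v})\<^esub> b"
proof
  assume reach: "a \<rightarrow>\<^sup>*\<^bsub>G \<restriction> (verts G - {v})\<^esub> b"
  have walk: "vwalk (q @ [a, v, b] @ r) G"
    and len: "length (q @ [a, v, b] @ r) = Suc (gdist (hd (q @ [a, v, b] @ r)) (last (q @ [a, v, b] @ r)))"
    using p by (auto simp only: isometric_path_iff)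
  have "a \<noteq> b" using minimal_vwalk_distinct[OF walk len] by auto
  have "vwalk ((q @ [a]) @ [v, b] @ r) G" "vwalk ((q @ [a, v]) @ (b # r)) G"
    using walk by auto
  then have parts: "vwalk (q @ [a]) G" "vwalk (b # r) G" "(a, v) \<in> arcs_ends G" "(v, b) \<in> arcs_ends G"
    using vwalk_append_iff[of "q @ [a]" "[v, b] @ r" G] vwalk_append_iff[of "q @ [a, v]" "b # r" G]
    by auto
  then have "(a, b) \<in> arcs_ends G"
    using neighbours_adjacent_if_reachable \<open>a \<noteq> b\<close> reach graph_symmetric by blast
  then have "vwalk ((q @ [a]) @ (b # r)) G"
    using parts by (subst vwalk_append_iff) auto
  from gdist_less_length[OF this] len show False
    by (cases q) auto
qed

lemma non_cut_vertex_endpoint: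
  assumes p: "isometric_path G p" and v: "v \<in> set p" "\<not> cut_vertex G v"
  shows "v = hd p \<or> v = last p"
proof (rule ccontr)
  assume no_end: "\<not> (v = hd p \<or> v = last p)"
  obtain q r where qr: "p = q @ v # r" using v by (auto dest: split_list)
  have "q \<noteq> []" "r \<noteq> []" using no_end qr by auto
  then obtain q' a b r' where "q = q' @ [a]" "r = b # r'"
    by (metis append_butlast_last_id neq_Nil_conv)
  then have p': "p = q' @ [a, v, b] @ r'" using qr by simp
  have "vwalk p G" "distinct p" using p by (auto simp: isometric_path_iff minimal_vwalk_distinct)
  then have "v \<in> verts G" "a \<in> verts G - {v}" "b \<in> verts G - {v}" using p' by auto
  then have "cut_vertex G v"
    using isometric_path_interior_separates p p' cut_vertex_iff[OF connected] by blast
  with v show False by simp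
qed

text \<open>In case of equality, shortest walks from \<open>x\<close> to \<open>v\<close> and from
  \<open>v\<close> to \<open>y\<close> join to an isometric path with \<open>v\<close> inside. The
  neighbours of \<open>v\<close> on it lie in the component of \<open>x\<close> and
  \<open>y\<close>, which contradicts \<open>isometric_path_interior_separates\<close>. In a cycle
  of length four equality does occur, so the strictness rests on the completeness of blocks.\<close>

lemma gdist_less_add_if_reachable:
  assumes v: "v \<in> verts G" and xy: "x \<rightarrow>\<^sup>*\<^bsub>G \<restriction> (verts G - {v})\<^esub> y"
  shows "gdist x y < gdist x v + gdist v y"
proof (rule ccontr)
  interpret D: graph "G \<restriction> (verts G - {v})" by (rule graph_induce) auto
  assume ge: "\<not> gdist x y < gdist x v + gdist v y"
  have x: "x \<in> verts G" "x \<noteq> v" and y: "y \<in> verts G" "y \<noteq> v"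
    using D.reachable_in_verts[OF xy] by auto
  obtain p where p: "vwalk p G" "hd p = x" "last p = v" "length p = Suc (gdist x v)"
    using x v by (blast intro: ex_gdist_vwalk)
  obtain q where q: "vwalk q G" "hd q = v" "last q = y" "length q = Suc (gdist v y)"
    using y v by (blast intro: ex_gdist_vwalk)
  \<comment> \<open>Since \<open>x\<close> and \<open>y\<close> differ from \<open>v\<close>, the
    joined walk has a neighbour of \<open>v\<close> on either side: \<open>a\<close> before and
    \<open>b\<close> after.\<close>
  have "tl q \<noteq> []" using q y by (cases q) auto
  then obtain b r' where "tl q = b # r'" by (meson neq_Nil_conv)
  then have q': "q = v # b # r'" using q by (cases q) auto
  have "butlast p \<noteq> []" using p x by (cases p) auto
  then obtain q1 a where "butlast p = q1 @ [a]" by (metis append_butlast_last_id)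
  then have p': "p = q1 @ [a, v]" using p append_butlast_last_id[of p] by (cases p) auto
  define w where "w = q1 @ [a, v, b] @ r'"
  have join: "w = p \<oplus> q" by (simp add: w_def p' q' vwalk_join_def)
  have walk: "vwalk w G" unfolding join using p q by (intro vwalk_joinI_vwalk') auto
  have hd_last: "hd w = x" "last w = y" using p q by (auto simp: w_def p' q' hd_append)
  have "length w = Suc (gdist x v + gdist v y)" using p q by (simp add: w_def p' q')
  then have len: "length w = Suc (gdist (hd w) (last w))"
    using ge gdist_less_length[OF walk] hd_last by auto
  then have dist: "distinct w" using minimal_vwalk_distinct walk by blast
  have iso: "isometric_path G w" using walk len by (simp add: isometric_path_iff)
  have "vwalk ((q1 @ [a]) @ [v, b] @ r') G" "vwalk ((q1 @ [a, v]) @ (b # r')) G"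
    using walk by (auto simp: w_def)
  then have parts: "vwalk (q1 @ [a]) G" "vwalk (b # r') G"
    using vwalk_append_iff[of "q1 @ [a]" "[v, b] @ r'" G] vwalk_append_iff[of "q1 @ [a, v]" "b # r'" G]
    by auto
  have "x \<in> set (q1 @ [a])" using p p' by (cases q1) auto
  \<comment> \<open>As \<open>w\<close> is distinct, \<open>v\<close> does not recur in either of
    the two parts.\<close>
  moreover have "set (q1 @ [a]) \<subseteq> verts G - {v}" using parts dist by (auto simp: w_def vwalk_def)
  ultimately have ax: "a \<rightarrow>\<^sup>*\<^bsub>G \<restriction> (verts G - {v})\<^esub> x"
    using vwalk_reachable_induce[OF parts(1)] by simp
  have "y \<in> set (b # r')" using q q' by auto
  moreover have "set (b # r') \<subseteq> verts G - {v}" using parts dist by (auto simp: w_def vwalk_def)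
  ultimately have "y \<rightarrow>\<^sup>*\<^bsub>G \<restriction> (verts G - {v})\<^esub> b"
    using vwalk_reachable_induce[OF parts(2)] by simp
  then have "a \<rightarrow>\<^sup>*\<^bsub>G \<restriction> (verts G - {v})\<^esub> b" using ax xy D.reachable_trans by blast
  then show False using isometric_path_interior_separates iso unfolding w_def by blast
qed

section \<open>Lower and upper bound for the isometric-path number\<close>

lemma nc_le_isometric_path_cover:
  assumes "isometric_path_cover G P"
  shows "nc G \<le> 2 * card P"
proof -
  have P: "finite P" using assms by (simp add: isometric_path_cover_def)
  have "{v \<in> verts G. \<not> cut_vertex G v} \<subseteq> hd ` P \<union> last ` P"
    using assms non_cut_vertex_endpoint by (fastforce simp: isometric_path_cover_def)
  then have "nc G \<le> card (hd ` P \<union> last ` P)"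
    unfolding nc_def using P by (intro card_mono) auto
  also have "\<dots> \<le> card (hd ` P) + card (last ` P)" by (rule card_Un_le)
  also have "\<dots> \<le> 2 * card P" using P card_image_le[of P hd] card_image_le[of P last] by simp
  finally show ?thesis .
qed

lemma ex_isometric_path_cover:
  obtains P where "isometric_path_cover G P" "card P \<le> (nc G + 1) div 2"
proof -
  define N where "N = {v \<in> verts G. \<not> cut_vertex G v}"
  have N: "finite N" "N \<noteq> {}" "N \<subseteq> verts G" "card N = nc G"
    using ex_non_cut_vertex by (auto simp: N_def nc_def)
  define k where "k = (nc G + 1) div 2"
  have nc_pos: "0 < nc G" using N by (metis card_gt_0_iff)
  then have k: "k \<le> nc G" "nc G \<le> 2 * k" by (auto simp: k_def)
  \<comment> \<open>The pairs are \<open>x i\<close>, \<open>y i\<close> for \<open>i < k\<close>.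
    Only the union of the images is prescribed, so a vertex may occur twice, and exchanging partners
    preserves the condition.\<close>
  define pairing where "pairing = (\<lambda>(x, y). x ` {..<k} \<union> y ` {..<k} = N)"
  define total where "total = (\<lambda>(x, y). \<Sum>i<k. gdist (x i) (y i))"
  obtain e where e: "bij_betw e {0..<nc G} N"
    using ex_bij_betw_nat_finite[OF N(1)] N(4) by auto
  \<comment> \<open>The default \<open>e 0\<close> is used only for odd \<open>nc G\<close>, in the
    last pair: there \<open>nc G = 2 * k - 1\<close> and \<open>k + i = nc G\<close> for
    \<open>i = k - 1\<close>.\<close>
  have "pairing (e, \<lambda>i. if k + i < nc G then e (k + i) else e 0)"
    unfolding pairing_def prod.case
  proof (intro equalityI subsetI)
    fix n assume "n \<in> N"
    then obtain i where i: "i < nc G" "n = e i" using e by (auto simp: bij_betw_def)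
    show "n \<in> e ` {..<k} \<union> (\<lambda>i. if k + i < nc G then e (k + i) else e 0) ` {..<k}"
    proof (cases "i < k")
      case False
      then show ?thesis using i k by (intro UnI2 image_eqI[of _ _ "i - k"]) auto
    qed (use i in auto)
  next
    fix n assume "n \<in> e ` {..<k} \<union> (\<lambda>i. if k + i < nc G then e (k + i) else e 0) ` {..<k}"
    then show "n \<in> N" using k nc_pos bij_betwE[OF e] by (auto split: if_splits)
  qed
  \<comment> \<open>Every distance is less than the number of vertices; this bound lets a pairing of
    maximal total be chosen.\<close>
  moreover have "\<forall>f. pairing f \<longrightarrow> total f < Suc (k * card (verts G))"
  proof (intro allI impI)
    fix f assume "pairing f"
    then have f: "fst f i \<in> verts G" "snd f i \<in> verts G" if "i < k" for i
      using that N(3) by (auto simp: pairing_def split: prod.splits)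
    have "total f \<le> (\<Sum>i<k. card (verts G))"
      unfolding total_def case_prod_beta using f
      by (intro sum_mono) (auto intro!: less_imp_le gdist_less_card)
    then show "total f < Suc (k * card (verts G))" by simp
  qed
  ultimately obtain f where "pairing f" "\<And>g. pairing g \<Longrightarrow> total g \<le> total f"
    using ex_has_greatest_nat[of pairing _ total] by blast
  then obtain x y where xy: "x ` {..<k} \<union> y ` {..<k} = N"
    and max: "\<And>x' y'. x' ` {..<k} \<union> y' ` {..<k} = N \<Longrightarrow>
      (\<Sum>i<k. gdist (x' i) (y' i)) \<le> (\<Sum>i<k. gdist (x i) (y i))"
    by (cases f) (force simp: pairing_def total_def)
  have xyV: "x i \<in> verts G" "y i \<in> verts G" if "i < k" for i
    using that xy N(3) by auto
  then have "\<exists>p. isometric_path G p \<and> hd p = x i \<and> last p = y i" if "i < k" for i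
    using that ex_isometric_path by metis
  then obtain p where p: "\<And>i. i < k \<Longrightarrow> isometric_path G (p i) \<and> hd (p i) = x i \<and> last (p i) = y i"
    by metis
  have ends: "x i \<in> set (p i)" "y i \<in> set (p i)" and walk: "vwalk (p i) G" if "i < k" for i
  proof -
    show "vwalk (p i) G" using p[OF that] by (simp add: isometric_path_iff)
    then have "p i \<noteq> []" by auto
    then show "x i \<in> set (p i)" "y i \<in> set (p i)" using p[OF that] by (metis hd_in_set, metis last_in_set)
  qed
  have covered: "\<exists>i<k. v \<in> set (p i)" if v: "v \<in> verts G" for v
  proof (rule ccontr)
    assume "\<not> (\<exists>i<k. v \<in> set (p i))"
    then have uncov: "v \<notin> set (p i)" if "i < k" for i using that by blast
    have "v \<notin> N"
      using uncov ends unfolding xy[symmetric] by blast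
    then have "cut_vertex G v" using v by (simp add: N_def)
    let ?D = "G \<restriction> (verts G - {v})"
    interpret D: graph ?D by (rule graph_induce) auto
    have joined: "x i \<rightarrow>\<^sup>*\<^bsub>?D\<^esub> y i" if i: "i < k" for i
    proof (rule vwalk_reachable_induce[OF walk[OF i]])
      show "set (p i) \<subseteq> verts G - {v}" using uncov[OF i] walk[OF i] by auto
    qed (use ends i in auto)
    obtain a b where ab: "a \<in> verts G - {v}" "b \<in> verts G - {v}" "\<not> a \<rightarrow>\<^sup>*\<^bsub>?D\<^esub> b"
      using cut_vertex_iff[OF connected v] \<open>cut_vertex G v\<close> by blast
    \<comment> \<open>Each component left after deleting \<open>v\<close> contains a non-cut-vertex
      and, as no pair is separated, its partner too.\<close>
    have repr: "\<exists>i<k. c \<rightarrow>\<^sup>*\<^bsub>?D\<^esub> x i \<and> c \<rightarrow>\<^sup>*\<^bsub>?D\<^esub> y i" if c: "c \<in> verts G - {v}" for c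
    proof -
      obtain w where w: "w \<in> N" "c \<rightarrow>\<^sup>*\<^bsub>?D\<^esub> w"
        using ex_non_cut_vertex_in_component[OF v c] by (auto simp: N_def)
      then obtain i where "i < k" "w = x i \<or> w = y i" using xy by blast
      then show ?thesis
        using w joined[OF \<open>i < k\<close>] D.reachable_trans D.symmetric_reachable' by blast
    qed
    obtain i where i: "i < k" "a \<rightarrow>\<^sup>*\<^bsub>?D\<^esub> x i" "a \<rightarrow>\<^sup>*\<^bsub>?D\<^esub> y i" using repr ab by blast
    obtain j where j: "j < k" "b \<rightarrow>\<^sup>*\<^bsub>?D\<^esub> x j" "b \<rightarrow>\<^sup>*\<^bsub>?D\<^esub> y j" using repr ab by blast
    have sep: "\<not> x i \<rightarrow>\<^sup>*\<^bsub>?D\<^esub> y j" "\<not> x j \<rightarrow>\<^sup>*\<^bsub>?D\<^esub> y i"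
      using ab i j D.reachable_trans D.symmetric_reachable' by blast+
    have "i \<noteq> j" using sep joined i by blast
    \<comment> \<open>The pairs \<open>i\<close> and \<open>j\<close> exchange partners across the
      two components. The image of \<open>y\<close> is unchanged, so maximality applies to
      \<open>y'\<close>.\<close>
    define y' where "y' = y(i := y j, j := y i)"
    have "y' ` {..<k} = y ` {..<k}"
      using i(1) j(1) \<open>i \<noteq> j\<close> by (auto simp: y'_def image_iff)
    then have "(\<Sum>l<k. gdist (x l) (y' l)) \<le> (\<Sum>l<k. gdist (x l) (y l))"
      using max xy by metis
    moreover have split: "(\<Sum>l<k. h l) = h i + h j + (\<Sum>l \<in> {..<k} - {i} - {j}. h l)" for h :: "nat \<Rightarrow> nat"
      using i(1) j(1) \<open>i \<noteq> j\<close> by (simp add: sum.remove[of "{..<k}" i] sum.remove[of "{..<k} - {i}" j])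
    moreover have "(\<Sum>l \<in> {..<k} - {i} - {j}. gdist (x l) (y' l)) = (\<Sum>l \<in> {..<k} - {i} - {j}. gdist (x l) (y l))"
      by (intro sum.cong) (auto simp: y'_def)
    ultimately have "gdist (x i) (y j) + gdist (x j) (y i) \<le> gdist (x i) (y i) + gdist (x j) (y j)"
      using \<open>i \<noteq> j\<close> by (simp add: y'_def)
    \<comment> \<open>Both totals are compared with the sum of the distances of the four ends to or
      from \<open>v\<close>: the new pairs reach it, the old ones stay strictly below.\<close>
    moreover have "gdist (x i) v + gdist v (y j) \<le> gdist (x i) (y j)"
      "gdist (x j) v + gdist v (y i) \<le> gdist (x j) (y i)"
      using gdist_add_le_if_separated v xyV i(1) j(1) sep by auto
    moreover have "gdist (x i) (y i) < gdist (x i) v + gdist v (y i)"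
      "gdist (x j) (y j) < gdist (x j) v + gdist v (y j)"
      using gdist_less_add_if_reachable v joined i(1) j(1) by auto
    ultimately show False by linarith
  qed
  have "isometric_path_cover G (p ` {..<k})"
    using p covered by (auto simp: isometric_path_cover_def)
  moreover have "card (p ` {..<k}) \<le> k" using card_image_le[of "{..<k}" p] by simp
  ultimately show ?thesis using that by (simp add: k_def)
qed

lemma ip_eq: "ip G = (nc G + 1) div 2"
proof (rule antisym)
  obtain P where P: "isometric_path_cover G P" "card P \<le> (nc G + 1) div 2"
    by (rule ex_isometric_path_cover)
  then have "ip G \<le> card P" unfolding ip_def by (intro Least_le) blast
  with P show "ip G \<le> (nc G + 1) div 2" by simp
  have "\<exists>k P. isometric_path_cover G P \<and> card P = k" using P by blast
  from LeastI_ex[OF this] obtain Q where "isometric_path_cover G Q" "card Q = ip G"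
    unfolding ip_def by blast
  then show "(nc G + 1) div 2 \<le> ip G" using nc_le_isometric_path_cover[of Q] by simp
qed

end

theorem corollary4:
  fixes G :: "('a, 'b) pre_digraph"
  assumes "graph G" and "verts G \<noteq> {}" and "connected G" and "block_graph G"
  shows "int (ip G) = \<lceil>real (nc G) / 2\<rceil>"
proof -
  interpret connected_block_graph G
    using assms by (simp add: connected_block_graph_def connected_graph_def
        connected_graph_axioms_def connected_block_graph_axioms_def)
  \<comment> \<open>The two parities of \<open>nc G\<close>: half of it is \<open>ip G\<close> or
    \<open>ip G - 1/2\<close>, and both round up to \<open>ip G\<close>.\<close>
  have "nc G = 2 * ip G \<or> nc G + 1 = 2 * ip G" unfolding ip_eq by presburger
  then have "\<lceil>real (nc G) / 2\<rceil> = int (ip G)" by (intro ceiling_unique) auto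
  then show ?thesis by simp
qed

end
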